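(* Let $KB=\langle P,Ab,IC,K\rangle$ be a Horn knowledge base and let a revision function $\dotplus$ be such that for every sentence $\alpha$ that is rejected in $KB$, $Mod(KB\dotplus\alpha)$ is a non-empty subset of $Mod(\lor\Delta^{\bullet})$, where $\Delta^{\bullet}$ is the set of all minimal abductive explanations for $\alpha$ with respect to $KB$. Then (for such $\alpha$) there exists an order $\leq_{KB}$ on $\mathcal{S}=Mod(IC)$ satisfying all the rationality axioms $(\leq1)$ to $(\leq5)$ such that $Mod(KB\dotplus\alpha)=Min(Mod(\{\alpha\}\cup IC),\leq_{KB})$.
   Context: Fix a first-order language $\mathcal{L}$; "sentence" means a sentence of $\mathcal{L}$. A Horn knowledge base is a tuple $KB=\langle P,Ab,IC,K\rangle$ where: $P$ is an acyclic normal logic program (there is a level mapping from ground atoms to $\mathbb{N}$ such that in every ground clause $H\leftarrow L_1,\dots,L_n$ of $P$ the level of $H$ exceeds that of each $L_i$, with $|\neg A|=|A|$), all abducibles at level $0$ and no non-abducible at level $0$; $Ab$ is a set of atoms (abducibles); $IC$ is a set of sentences (integrity constraints); $K$ is a set of sentences whose atoms are all in $Ab$. An abductive interpretation is a set $I\subseteq Ab$. A level-$0$ atom $A$ is true in $I$ iff $A\in I$; an atom $A$ of level $n>0$ is true in $I$ iff some clause $A\leftarrow L_1,\dots,L_k$ of the ground instantiation of $P$ has all positive $L_j$ true in $I$ and, for every negative $L_j=\neg B_j$, $B_j$ false in $I$. Truth extends to sentences classically ($\forall$/$\exists$ via ground instances). $Mod(X)$ is the set of abductive interpretations making the sentence (or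 all sentences of the set) $X$ true; $Cn_P(X)=\{\alpha: Mod(X)\subseteq Mod(\alpha)\}$; $Mod(KB)=Mod(K\cup IC)$; $KB^\bullet=Cn_P(K\cup IC)$; $\alpha$ is rejected in $KB$ iff $\neg\alpha\in KB^\bullet$. $KB_1\equiv KB_2$ iff $P_1=P_2,Ab_1=Ab_2,IC_1=IC_2$ and $Mod(K_1)=Mod(K_2)$. A revision function assigns to $KB$ and a sentence $\alpha$ a Horn knowledge base $KB\dotplus\alpha$. Orders: for a relation $\leq_{KB}$ on $\mathcal{S}=Mod(IC)$, $I_1<_{KB}I_2$ iff $I_1\leq_{KB}I_2$ and not $I_2\leq_{KB}I_1$; $Min(\mathcal{F},\leq_{KB})=\{I\in\mathcal{F}:\text{no }I'\in\mathcal{F}\text{ with }I'<_{KB}I\}$. $(\leq1)$ reflexive and transitive; $(\leq2)$ total on $\mathcal{S}$; $(\leq3)$ $I\in Min(\mathcal{S},\leq_{KB})$ iff $I\in Mod(KB)$; $(\leq4)$ $Min(\mathcal{F},\leq_{KB})\neq\emptyset$ for every non-empty $\mathcal{F}\subseteq\mathcal{S}$; $(\leq5)$ if $KB\equiv KB'$ then $\leq_{KB}=\leq_{KB'}$. An abductive literal is an abducible $A\in Ab$ or its negation $\neg A$. An abductive explanation for $\alpha$ w.r.t. $KB$ is a set $\Delta$ of abductive literals such that $\Delta$ is consistent with $IC$ (i.e. $Mod(\Delta\cup IC)\neq\emptyset$) and $\alpha\in Cn_P(\Delta)$; it is minimal if no proper subset of $\Delta$ is an abductive explanation for $\alpha$.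 For two minimal abductive explanations, $\Delta_1\lor\Delta_2=(\Delta_1\cap\Delta_2)\cup\{\gamma\lor\delta:\gamma\in\Delta_1\setminus\Delta_2,\ \delta\in\Delta_2\setminus\Delta_1\}$; for a set $\Delta^\bullet$ of minimal abductive explanations, $\lor\Delta^\bullet$ is the iterated disjunction of all its elements in this sense.
   Formalization: Revision is required to keep P, Ab and IC. As no revision meets the condition for contradictory α, the claim is also proved for each rejected α separately, assuming Mod(KB) non-empty (otherwise (≤3) and (≤4) conflict). *)

theory Defs
  imports Main
begin

subsection \<open>First-order languages\<close>

text \<open>A language is given by its function symbols (constants have arity 0) and its predicate
  symbols, each with an arity.  The signature is explicit because quantifiers range over the
  ground terms of the language, so that, e.g., function-free languages differ from others.\<close>

record ('f, 'p) lang =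
  funs :: "('f \<times> nat) set"
  preds :: "('p \<times> nat) set"

datatype 'f trm = Var nat | Fun 'f "'f trm list"

type_synonym ('f, 'p) atom = "'p \<times> 'f trm list"

datatype ('f, 'p) fm =
    Atom "('f, 'p) atom"
  | Neg "('f, 'p) fm"
  | Conj "('f, 'p) fm" "('f, 'p) fm"
  | Disj "('f, 'p) fm" "('f, 'p) fm"
  | Impl "('f, 'p) fm" "('f, 'p) fm"
  | Forall nat "('f, 'p) fm"
  | Exists nat "('f, 'p) fm"

fun wf_trm :: "('f, 'p) lang \<Rightarrow> 'f trm \<Rightarrow> bool" where
  "wf_trm L (Var x) = True"
| "wf_trm L (Fun f ts) = ((f, length ts) \<in> funs L \<and> (\<forall>t \<in> set ts. wf_trm L t))"

fun vars_trm :: "'f trm \<Rightarrow> nat set" where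
  "vars_trm (Var x) = {x}"
| "vars_trm (Fun f ts) = (\<Union>t \<in> set ts. vars_trm t)"

primrec subst_trm :: "(nat \<Rightarrow> 'f trm) \<Rightarrow> 'f trm \<Rightarrow> 'f trm" where
  "subst_trm \<sigma> (Var x) = \<sigma> x"
| "subst_trm \<sigma> (Fun f ts) = Fun f (map (subst_trm \<sigma>) ts)"

definition ground_trms :: "('f, 'p) lang \<Rightarrow> 'f trm set" where
  "ground_trms L = {t. wf_trm L t \<and> vars_trm t = {}}"

definition wf_atom :: "('f, 'p) lang \<Rightarrow> ('f, 'p) atom \<Rightarrow> bool" where
  "wf_atom L A \<longleftrightarrow> (fst A, length (snd A)) \<in> preds L \<and> (\<forall>t \<in> set (snd A). wf_trm L t)"

definition vars_atom :: "('f, 'p) atom \<Rightarrow> nat set" where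
  "vars_atom A = (\<Union>t \<in> set (snd A). vars_trm t)"

definition subst_atom :: "(nat \<Rightarrow> 'f trm) \<Rightarrow> ('f, 'p) atom \<Rightarrow> ('f, 'p) atom" where
  "subst_atom \<sigma> A = (fst A, map (subst_trm \<sigma>) (snd A))"

definition ground_atoms :: "('f, 'p) lang \<Rightarrow> ('f, 'p) atom set" where
  "ground_atoms L = {A. wf_atom L A \<and> vars_atom A = {}}"

primrec atoms_fm :: "('f, 'p) fm \<Rightarrow> ('f, 'p) atom set" where
  "atoms_fm (Atom A) = {A}"
| "atoms_fm (Neg \<phi>) = atoms_fm \<phi>"
| "atoms_fm (Conj \<phi> \<psi>) = atoms_fm \<phi> \<union> atoms_fm \<psi>"
| "atoms_fm (Disj \<phi> \<psi>) = atoms_fm \<phi> \<union> atoms_fm \<psi>"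
| "atoms_fm (Impl \<phi> \<psi>) = atoms_fm \<phi> \<union> atoms_fm \<psi>"
| "atoms_fm (Forall x \<phi>) = atoms_fm \<phi>"
| "atoms_fm (Exists x \<phi>) = atoms_fm \<phi>"

primrec free_vars :: "('f, 'p) fm \<Rightarrow> nat set" where
  "free_vars (Atom A) = vars_atom A"
| "free_vars (Neg \<phi>) = free_vars \<phi>"
| "free_vars (Conj \<phi> \<psi>) = free_vars \<phi> \<union> free_vars \<psi>"
| "free_vars (Disj \<phi> \<psi>) = free_vars \<phi> \<union> free_vars \<psi>"
| "free_vars (Impl \<phi> \<psi>) = free_vars \<phi> \<union> free_vars \<psi>"
| "free_vars (Forall x \<phi>) = free_vars \<phi> - {x}"
| "free_vars (Exists x \<phi>) = free_vars \<phi> - {x}"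

definition sentences :: "('f, 'p) lang \<Rightarrow> ('f, 'p) fm set" where
  "sentences L = {\<phi>. (\<forall>A \<in> atoms_fm \<phi>. wf_atom L A) \<and> free_vars \<phi> = {}}"

text \<open>Truth relative to a universe \<open>U\<close> of ground terms and a set \<open>T\<close> of true ground atoms; \<open>\<sigma>\<close>
  records the ground terms already substituted for the variables bound further out.\<close>

primrec holds ::
  "'f trm set \<Rightarrow> ('f, 'p) atom set \<Rightarrow> (nat \<Rightarrow> 'f trm) \<Rightarrow> ('f, 'p) fm \<Rightarrow> bool" where
  "holds U T \<sigma> (Atom A) \<longleftrightarrow> subst_atom \<sigma> A \<in> T"
| "holds U T \<sigma> (Neg \<phi>) \<longleftrightarrow> \<not> holds U T \<sigma> \<phi>"
| "holds U T \<sigma> (Conj \<phi> \<psi>) \<longleftrightarrow> holds U T \<sigma> \<phi> \<and> holds U T \<sigma> \<psi>"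
| "holds U T \<sigma> (Disj \<phi> \<psi>) \<longleftrightarrow> holds U T \<sigma> \<phi> \<or> holds U T \<sigma> \<psi>"
| "holds U T \<sigma> (Impl \<phi> \<psi>) \<longleftrightarrow> (holds U T \<sigma> \<phi> \<longrightarrow> holds U T \<sigma> \<psi>)"
| "holds U T \<sigma> (Forall x \<phi>) \<longleftrightarrow> (\<forall>t \<in> U. holds U T (\<sigma>(x := t)) \<phi>)"
| "holds U T \<sigma> (Exists x \<phi>) \<longleftrightarrow> (\<exists>t \<in> U. holds U T (\<sigma>(x := t)) \<phi>)"


subsection \<open>Horn knowledge bases\<close>

datatype ('f, 'p) lit = PosL (atom_of: "('f, 'p) atom") | NegL (atom_of: "('f, 'p) atom")

datatype ('f, 'p) clause = Clause (head: "('f, 'p) atom") (body: "('f, 'p) lit list")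

primrec subst_lit :: "(nat \<Rightarrow> 'f trm) \<Rightarrow> ('f, 'p) lit \<Rightarrow> ('f, 'p) lit" where
  "subst_lit \<sigma> (PosL A) = PosL (subst_atom \<sigma> A)"
| "subst_lit \<sigma> (NegL A) = NegL (subst_atom \<sigma> A)"

definition subst_clause :: "(nat \<Rightarrow> 'f trm) \<Rightarrow> ('f, 'p) clause \<Rightarrow> ('f, 'p) clause" where
  "subst_clause \<sigma> c = Clause (subst_atom \<sigma> (head c)) (map (subst_lit \<sigma>) (body c))"

definition wf_clause :: "('f, 'p) lang \<Rightarrow> ('f, 'p) clause \<Rightarrow> bool" where
  "wf_clause L c \<longleftrightarrow> wf_atom L (head c) \<and> (\<forall>l \<in> set (body c). wf_atom L (atom_of l))"

definition vars_clause :: "('f, 'p) clause \<Rightarrow> nat set" where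
  "vars_clause c = vars_atom (head c) \<union> (\<Union>l \<in> set (body c). vars_atom (atom_of l))"

definition ground_inst :: "('f, 'p) lang \<Rightarrow> ('f, 'p) clause set \<Rightarrow> ('f, 'p) clause set" where
  "ground_inst L P =
    {subst_clause \<sigma> c | \<sigma> c. c \<in> P \<and> (\<forall>x \<in> vars_clause c. \<sigma> x \<in> ground_trms L)}"

record ('f, 'p) kb =
  prog :: "('f, 'p) clause set"
  abd :: "('f, 'p) atom set"
  ic :: "('f, 'p) fm set"
  know :: "('f, 'p) fm set"

definition level_mapping ::
  "('f, 'p) lang \<Rightarrow> ('f, 'p) clause set \<Rightarrow> ('f, 'p) atom set \<Rightarrow> (('f, 'p) atom \<Rightarrow> nat) \<Rightarrow> bool"
where
  "level_mapping L P Ab level \<longleftrightarrow>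
     (\<forall>c \<in> ground_inst L P. \<forall>l \<in> set (body c). level (atom_of l) < level (head c)) \<and>
     (\<forall>A \<in> ground_atoms L. level A = 0 \<longleftrightarrow> A \<in> Ab)"

text \<open>For a sentence with quantifiers, the atoms required to be abducible are the ground instances
  of the atoms occurring in it.\<close>

definition horn_kb :: "('f, 'p) lang \<Rightarrow> ('f, 'p) kb \<Rightarrow> bool" where
  "horn_kb L KB \<longleftrightarrow>
     (\<forall>c \<in> prog KB. wf_clause L c) \<and>
     abd KB \<subseteq> ground_atoms L \<and>
     (\<exists>level. level_mapping L (prog KB) (abd KB) level) \<and>
     ic KB \<subseteq> sentences L \<and>
     know KB \<subseteq> sentences L \<and>
     (\<forall>\<phi> \<in> know KB. \<forall>A \<in> atoms_fm \<phi>. \<forall>\<sigma>.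
        (\<forall>x \<in> vars_atom A. \<sigma> x \<in> ground_trms L) \<longrightarrow> subst_atom \<sigma> A \<in> abd KB)"


subsection \<open>Abductive interpretations\<close>

primrec lit_true :: "('f, 'p) atom set \<Rightarrow> ('f, 'p) lit \<Rightarrow> bool" where
  "lit_true T (PosL A) \<longleftrightarrow> A \<in> T"
| "lit_true T (NegL A) \<longleftrightarrow> A \<notin> T"

text \<open>The recursive truth conditions for ground atoms.  Level 0 is the same as being abducible,
  so they do not depend on the choice of the level mapping; by acyclicity they determine \<open>T\<close>
  (see \<open>ex1_atom_truth\<close> below).\<close>

definition atom_truth :: "('f, 'p) lang \<Rightarrow> ('f, 'p) kb \<Rightarrow> ('f, 'p) atom set \<Rightarrow> ('f, 'p) atom set \<Rightarrow> bool"
where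
  "atom_truth L KB I T \<longleftrightarrow>
     T \<subseteq> ground_atoms L \<and>
     (\<forall>A \<in> ground_atoms L.
        A \<in> T \<longleftrightarrow>
          (if A \<in> abd KB then A \<in> I
           else \<exists>c \<in> ground_inst L (prog KB). head c = A \<and> (\<forall>l \<in> set (body c). lit_true T l)))"

lemma ex1_atom_truth:
  fixes L :: "('f, 'p) lang"
  assumes "horn_kb L KB"
  shows "\<exists>!T. atom_truth L KB I T"
proof -
  define step where "step T = {A \<in> ground_atoms L. if A \<in> abd KB then A \<in> I
      else \<exists>c \<in> ground_inst L (prog KB). head c = A \<and> (\<forall>l \<in> set (body c). lit_true T l)}" for T
  have truth_iff: "atom_truth L KB I T \<longleftrightarrow> T = step T" for T
    unfolding atom_truth_def step_def by blast
  obtain level where "level_mapping L (prog KB) (abd KB) level"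
    using assms unfolding horn_kb_def by blast
  then have less: "level (atom_of l) < level (head c)"
    if "c \<in> ground_inst L (prog KB)" "l \<in> set (body c)" for c l
    using that unfolding level_mapping_def by blast
  have lit: "lit_true X l \<longleftrightarrow> lit_true Y l" if "atom_of l \<in> X \<longleftrightarrow> atom_of l \<in> Y" for X Y and l :: "('f, 'p) lit"
    using that by (cases l) auto
  have agree: "A \<in> step X \<longleftrightarrow> A \<in> step Y"
    if XY: "\<And>B. level B < level A \<Longrightarrow> B \<in> X \<longleftrightarrow> B \<in> Y" for A X Y
  proof -
    have "(\<forall>l \<in> set (body c). lit_true X l) \<longleftrightarrow> (\<forall>l \<in> set (body c). lit_true Y l)"
      if "c \<in> ground_inst L (prog KB)" "head c = A" for c
      using less lit XY that by blast
    then show ?thesis unfolding step_def by auto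
  qed
  define stage where "stage n = (step ^^ n) {}" for n
  have stage_Suc: "stage (Suc n) = step (stage n)" for n
    by (simp add: stage_def)
  have stable: "A \<in> stage n \<longleftrightarrow> A \<in> stage (Suc (level A))" if "level A < n" for n A
    using that
  proof (induction "level A" arbitrary: n A rule: less_induct)
    case less
    then obtain m where m: "n = Suc m" "level A \<le> m" by (cases n) auto
    have "B \<in> stage m \<longleftrightarrow> B \<in> stage (level A)" if "level B < level A" for B
      using less.hyps[OF that, of m] less.hyps[OF that, of "level A"] that m by simp
    then show ?case unfolding m stage_Suc by (rule agree)
  qed
  define T where "T = {A. A \<in> stage (Suc (level A))}"
  have "T = step T"
  proof (rule set_eqI)
    fix A
    have "A \<in> T \<longleftrightarrow> A \<in> step (stage (level A))" by (simp add: T_def stage_Suc)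
    also have "\<dots> \<longleftrightarrow> A \<in> step T" 
      by (rule agree) (use stable in \<open>unfold T_def mem_Collect_eq, blast\<close>)
    finally show "A \<in> T \<longleftrightarrow> A \<in> step T" .
  qed
  moreover have "X = Y" if "X = step X" "Y = step Y" for X Y
  proof (rule set_eqI)
    show "A \<in> X \<longleftrightarrow> A \<in> Y" for A
    proof (induction "level A" arbitrary: A rule: less_induct)
      case less
      then have "A \<in> step X \<longleftrightarrow> A \<in> step Y" by (rule agree)
      with that show ?case by simp
    qed
  qed
  ultimately show ?thesis unfolding truth_iff by blast
qed

definition true_atoms :: "('f, 'p) lang \<Rightarrow> ('f, 'p) kb \<Rightarrow> ('f, 'p) atom set \<Rightarrow> ('f, 'p) atom set" where
  "true_atoms L KB I = (THE T. atom_truth L KB I T)"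

text \<open>For sentences the initial substitution is irrelevant.\<close>

definition true_in :: "('f, 'p) lang \<Rightarrow> ('f, 'p) kb \<Rightarrow> ('f, 'p) atom set \<Rightarrow> ('f, 'p) fm \<Rightarrow> bool" where
  "true_in L KB I \<phi> \<longleftrightarrow> holds (ground_trms L) (true_atoms L KB I) Var \<phi>"

definition Mod :: "('f, 'p) lang \<Rightarrow> ('f, 'p) kb \<Rightarrow> ('f, 'p) fm set \<Rightarrow> ('f, 'p) atom set set" where
  "Mod L KB X = {I. I \<subseteq> abd KB \<and> (\<forall>\<phi> \<in> X. true_in L KB I \<phi>)}"

definition Cn :: "('f, 'p) lang \<Rightarrow> ('f, 'p) kb \<Rightarrow> ('f, 'p) fm set \<Rightarrow> ('f, 'p) fm set" where
  "Cn L KB X = {\<alpha> \<in> sentences L. Mod L KB X \<subseteq> Mod L KB {\<alpha>}}"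

definition Mod_kb :: "('f, 'p) lang \<Rightarrow> ('f, 'p) kb \<Rightarrow> ('f, 'p) atom set set" where
  "Mod_kb L KB = Mod L KB (know KB \<union> ic KB)"

definition closure_kb :: "('f, 'p) lang \<Rightarrow> ('f, 'p) kb \<Rightarrow> ('f, 'p) fm set" where
  "closure_kb L KB = Cn L KB (know KB \<union> ic KB)"

definition rejected :: "('f, 'p) lang \<Rightarrow> ('f, 'p) kb \<Rightarrow> ('f, 'p) fm \<Rightarrow> bool" where
  "rejected L KB \<alpha> \<longleftrightarrow> Neg \<alpha> \<in> closure_kb L KB"

definition equiv_kb :: "('f, 'p) lang \<Rightarrow> ('f, 'p) kb \<Rightarrow> ('f, 'p) kb \<Rightarrow> bool" where
  "equiv_kb L KB1 KB2 \<longleftrightarrow>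
     prog KB1 = prog KB2 \<and> abd KB1 = abd KB2 \<and> ic KB1 = ic KB2 \<and>
     Mod L KB1 (know KB1) = Mod L KB2 (know KB2)"

text \<open>Revision changes the current knowledge only; program, abducibles and integrity constraints
  are immutable.\<close>

definition revision_function ::
  "('f, 'p) lang \<Rightarrow> (('f, 'p) kb \<Rightarrow> ('f, 'p) fm \<Rightarrow> ('f, 'p) kb) \<Rightarrow> bool" where
  "revision_function L rv \<longleftrightarrow>
     (\<forall>KB \<alpha>. horn_kb L KB \<longrightarrow> \<alpha> \<in> sentences L \<longrightarrow>
        horn_kb L (rv KB \<alpha>) \<and> prog (rv KB \<alpha>) = prog KB \<and> abd (rv KB \<alpha>) = abd KB \<and>
        ic (rv KB \<alpha>) = ic KB)"


subsection \<open>Orders on interpretations\<close>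

definition strict :: "'i rel \<Rightarrow> 'i \<Rightarrow> 'i \<Rightarrow> bool" where
  "strict r I J \<longleftrightarrow> (I, J) \<in> r \<and> (J, I) \<notin> r"

definition minimals :: "'i set \<Rightarrow> 'i rel \<Rightarrow> 'i set" where
  "minimals F r = {I \<in> F. \<not> (\<exists>J \<in> F. strict r J I)}"

text \<open>The last axiom compares the orders of different knowledge bases, hence \<open>leq\<close> assigns
  a relation to every knowledge base.  The other four only concern the relation assigned to \<open>KB\<close>.\<close>

definition rational_order ::
  "('f, 'p) lang \<Rightarrow> ('f, 'p) kb \<Rightarrow> (('f, 'p) kb \<Rightarrow> ('f, 'p) atom set rel) \<Rightarrow> bool" where
  "rational_order L KB leq \<longleftrightarrow>
     (let S = Mod L KB (ic KB) in
       preorder_on S (leq KB) \<and>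
       total_on S (leq KB) \<and>
       (\<forall>I. I \<in> minimals S (leq KB) \<longleftrightarrow> I \<in> Mod_kb L KB) \<and>
       (\<forall>F. F \<subseteq> S \<longrightarrow> F \<noteq> {} \<longrightarrow> minimals F (leq KB) \<noteq> {}) \<and>
       (\<forall>KB1 KB2. horn_kb L KB1 \<longrightarrow> horn_kb L KB2 \<longrightarrow> equiv_kb L KB1 KB2 \<longrightarrow> leq KB1 = leq KB2))"


subsection \<open>Abductive explanations\<close>

definition abd_lits :: "('f, 'p) kb \<Rightarrow> ('f, 'p) fm set" where
  "abd_lits KB = Atom ` abd KB \<union> (\<lambda>A. Neg (Atom A)) ` abd KB"

definition explanation :: "('f, 'p) lang \<Rightarrow> ('f, 'p) kb \<Rightarrow> ('f, 'p) fm \<Rightarrow> ('f, 'p) fm set \<Rightarrow> bool" where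
  "explanation L KB \<alpha> \<Delta> \<longleftrightarrow>
     \<Delta> \<subseteq> abd_lits KB \<and> Mod L KB (\<Delta> \<union> ic KB) \<noteq> {} \<and> \<alpha> \<in> Cn L KB \<Delta>"

definition min_explanations :: "('f, 'p) lang \<Rightarrow> ('f, 'p) kb \<Rightarrow> ('f, 'p) fm \<Rightarrow> ('f, 'p) fm set set" where
  "min_explanations L KB \<alpha> =
     {\<Delta>. explanation L KB \<alpha> \<Delta> \<and> \<not> (\<exists>\<Delta>'. \<Delta>' \<subset> \<Delta> \<and> explanation L KB \<alpha> \<Delta>')}"

definition disj_expl :: "('f, 'p) fm set \<Rightarrow> ('f, 'p) fm set \<Rightarrow> ('f, 'p) fm set" where
  "disj_expl X Y = (X \<inter> Y) \<union> {Disj \<gamma> \<delta> | \<gamma> \<delta>. \<gamma> \<in> X - Y \<and> \<delta> \<in> Y - X}"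

definition iter_disj :: "('f, 'p) fm set list \<Rightarrow> ('f, 'p) fm set" where
  "iter_disj Ds = foldl disj_expl (hd Ds) (tl Ds)"

text \<open>The models of the iterated disjunction of a set of explanations.  For a finite set the
  enumeration used for the iteration does not affect the models, and the disjunction of no
  explanation has no model.  The iterated disjunction of infinitely many explanations is
  not a set of (finitary) sentences; it counts as true if that of finitely many of them is.\<close>

definition Mod_Disj_fin ::
  "('f, 'p) lang \<Rightarrow> ('f, 'p) kb \<Rightarrow> ('f, 'p) fm set set \<Rightarrow> ('f, 'p) atom set set" where
  "Mod_Disj_fin L KB D =
     {I. \<exists>Ds. Ds \<noteq> [] \<and> distinct Ds \<and> set Ds = D \<and> I \<in> Mod L KB (iter_disj Ds)}"

definition Mod_Disj ::
  "('f, 'p) lang \<Rightarrow> ('f, 'p) kb \<Rightarrow> ('f, 'p) fm set set \<Rightarrow> ('f, 'p) atom set set" where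
  "Mod_Disj L KB D =
     (if finite D then Mod_Disj_fin L KB D
      else (\<Union>F \<in> {F. finite F \<and> F \<subseteq> D}. Mod_Disj_fin L KB F))"

end

theory Submission
  imports Defs
begin

text \<open>A model of a disjunction of explanations is a model of one of them, hence of \<open>\<alpha>\<close>; so the
  revised models \<open>N\<close> lie in \<open>Mod ({\<alpha>} \<union> IC)\<close>, and they are disjoint from \<open>M = Mod KB\<close> because \<open>\<alpha>\<close>
  is rejected.  If \<open>M\<close> is non-empty, rank the models of \<open>IC\<close> by 0 on \<open>M\<close>, 1 on \<open>N\<close> and 2 elsewhere.
  If \<open>M\<close> is empty, every sentence is rejected, in particular a contradiction, whose revision
  would need a model; so the hypothesis on all rejected sentences rules this case out.\<close>

text \<open>Truth in an interpretation depends only on program and abducibles, which revision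
  preserves, so models of the revised and the original base can be compared.\<close>

lemma Mod_cong:
  assumes "prog KB1 = prog KB2" "abd KB1 = abd KB2"
  shows "Mod L KB1 X = Mod L KB2 X"
  using assms by (simp add: Mod_def true_in_def true_atoms_def atom_truth_def)

lemma Mod_Un: "Mod L KB (X \<union> Y) = Mod L KB X \<inter> Mod L KB Y"
  by (auto simp: Mod_def)

text \<open>If some \<gamma> of \<open>X\<close> fails, it lies outside \<open>Y\<close>, since
  common members hold; its disjunctions with the members of \<open>Y - X\<close> then force all of
  \<open>Y\<close>.\<close>

lemma Mod_disj_expl: "Mod L KB (disj_expl X Y) \<subseteq> Mod L KB X \<union> Mod L KB Y"
proof
  fix I assume "I \<in> Mod L KB (disj_expl X Y)"
  then have sub: "I \<subseteq> abd KB"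
    and common: "\<And>\<phi>. \<phi> \<in> X \<Longrightarrow> \<phi> \<in> Y \<Longrightarrow> true_in L KB I \<phi>"
    and disj: "\<And>\<gamma> \<delta>. \<gamma> \<in> X - Y \<Longrightarrow> \<delta> \<in> Y - X \<Longrightarrow> true_in L KB I (Disj \<gamma> \<delta>)"
    unfolding Mod_def disj_expl_def by blast+
  show "I \<in> Mod L KB X \<union> Mod L KB Y"
  proof (cases "\<forall>\<gamma> \<in> X. true_in L KB I \<gamma>")
    case True
    with sub show ?thesis by (simp add: Mod_def)
  next
    case False
    then obtain \<gamma> where "\<gamma> \<in> X - Y" "\<not> true_in L KB I \<gamma>"
      using common by blast
    then have "true_in L KB I \<delta>" if "\<delta> \<in> Y - X" for \<delta>
      using disj[OF _ that] by (auto simp: true_in_def)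
    with common sub show ?thesis by (auto simp: Mod_def)
  qed
qed

text \<open>Induction with the accumulator \<open>X\<close> arbitrary, since each step of the fold
  replaces it by \<open>disj_expl X D\<close>.\<close>

lemma Mod_foldl_disj_expl:
  "Mod L KB (foldl disj_expl X Ds) \<subseteq> Mod L KB X \<union> (\<Union>\<Delta> \<in> set Ds. Mod L KB \<Delta>)"
proof (induction Ds arbitrary: X)
  case Nil
  show ?case by simp
next
  case (Cons D Ds)
  show ?case using Cons.IH[of "disj_expl X D"] Mod_disj_expl[of L KB X D] by auto
qed

lemma Mod_iter_disj:
  assumes "Ds \<noteq> []"
  shows "Mod L KB (iter_disj Ds) \<subseteq> (\<Union>\<Delta> \<in> set Ds. Mod L KB \<Delta>)"
  using assms Mod_foldl_disj_expl[of L KB "hd Ds" "tl Ds"]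
  by (cases Ds) (simp_all add: iter_disj_def)

text \<open>The infinite case is a union over finite subsets of \<open>D\<close>, so one bound for
  every \<open>F \<subseteq> D\<close> covers both cases.\<close>

lemma Mod_Disj_subset: "Mod_Disj L KB D \<subseteq> (\<Union>\<Delta> \<in> D. Mod L KB \<Delta>)"
proof -
  have "Mod_Disj_fin L KB F \<subseteq> (\<Union>\<Delta> \<in> D. Mod L KB \<Delta>)" if "F \<subseteq> D" for F
  proof
    fix I assume "I \<in> Mod_Disj_fin L KB F"
    then obtain Ds where "Ds \<noteq> []" "set Ds = F" "I \<in> Mod L KB (iter_disj Ds)"
      by (auto simp: Mod_Disj_fin_def)
    with that show "I \<in> (\<Union>\<Delta> \<in> D. Mod L KB \<Delta>)"
      using Mod_iter_disj[of Ds L KB] by (meson UN_mono in_mono order.refl)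
  qed
  then have "Mod_Disj_fin L KB D \<subseteq> (\<Union>\<Delta> \<in> D. Mod L KB \<Delta>)"
    and "(\<Union>F \<in> {F. finite F \<and> F \<subseteq> D}. Mod_Disj_fin L KB F) \<subseteq> (\<Union>\<Delta> \<in> D. Mod L KB \<Delta>)"
    by (simp, intro UN_least) simp
  then show ?thesis by (simp add: Mod_Disj_def)
qed

lemma Mod_Disj_min_explanations: "Mod_Disj L KB (min_explanations L KB \<alpha>) \<subseteq> Mod L KB {\<alpha>}"
proof -
  have "Mod L KB \<Delta> \<subseteq> Mod L KB {\<alpha>}" if "\<Delta> \<in> min_explanations L KB \<alpha>" for \<Delta>
    using that by (simp add: min_explanations_def explanation_def Cn_def)
  then show ?thesis using Mod_Disj_subset[of L KB "min_explanations L KB \<alpha>"] by blast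
qed

lemma rejected_iff:
  assumes "\<alpha> \<in> sentences L"
  shows "rejected L KB \<alpha> \<longleftrightarrow> Mod_kb L KB \<inter> Mod L KB {\<alpha>} = {}"
proof -
  have "Neg \<alpha> \<in> sentences L"
    using assms by (simp add: sentences_def)
  then have "rejected L KB \<alpha> \<longleftrightarrow> (\<forall>I \<in> Mod_kb L KB. I \<in> Mod L KB {Neg \<alpha>})"
    by (simp add: rejected_def closure_kb_def Cn_def Mod_kb_def subset_eq)
  also have "\<dots> \<longleftrightarrow> (\<forall>I \<in> Mod_kb L KB. I \<notin> Mod L KB {\<alpha>})"
    by (rule ball_cong) (auto simp: Mod_kb_def Mod_def true_in_def)
  finally show ?thesis by blast
qed

text \<open>Ranks in the natural numbers make the relation total and give every non-empty set a
  minimal element.\<close>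

definition rank_rel :: "'i set \<Rightarrow> ('i \<Rightarrow> nat) \<Rightarrow> 'i rel" where
  "rank_rel S f = {(I, J) \<in> S \<times> S. f I \<le> f J}"

lemma preorder_on_rank_rel: "preorder_on S (rank_rel S f)"
  by (auto simp: preorder_on_def rank_rel_def refl_on_def intro!: transI)

lemma total_on_rank_rel: "total_on S (rank_rel S f)"
  by (auto simp: total_on_def rank_rel_def)

lemma minimals_rank_rel:
  assumes "F \<subseteq> S"
  shows "minimals F (rank_rel S f) = {I \<in> F. \<forall>J \<in> F. f I \<le> f J}"
  using assms by (auto simp: minimals_def strict_def rank_rel_def not_le; force)

lemma minimals_rank_rel_nonempty:
  assumes "F \<subseteq> S" "F \<noteq> {}"
  shows "minimals F (rank_rel S f) \<noteq> {}"
proof -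
  obtain I where "I \<in> F" "\<forall>J. J \<in> F \<longrightarrow> f I \<le> f J"
    using assms(2) ex_has_least_nat[of "\<lambda>I. I \<in> F" _ f] by blast
  then show ?thesis using assms(1) by (auto simp: minimals_rank_rel)
qed

text \<open>Abstract core of the theorem: \<open>F\<close> stands for the models of \<alpha> and the
  integrity constraints, \<open>N\<close> for the models of the revised base.\<close>

lemma ex_rational_order:
  fixes L :: "('f, 'p) lang"
  assumes M: "Mod_kb L KB \<noteq> {}"
    and F: "F \<subseteq> Mod L KB (ic KB)" "F \<inter> Mod_kb L KB = {}"
    and N: "N \<subseteq> F" "N \<noteq> {}"
  shows "\<exists>leq. rational_order L KB leq \<and> N = minimals F (leq KB)"
proof -
  define S where "S = Mod L KB (ic KB)"
  define f :: "('f, 'p) atom set \<Rightarrow> nat" where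
    "f I = (if I \<in> Mod_kb L KB then 0 else if I \<in> N then 1 else 2)" for I
  have MS: "Mod_kb L KB \<subseteq> S"
    by (auto simp: S_def Mod_kb_def Mod_def)
  have "I \<in> minimals S (rank_rel S f) \<longleftrightarrow> I \<in> Mod_kb L KB" for I
  proof -
    \<comment> \<open>Rank 0 is attained in \<open>S\<close>, so the minimal elements are exactly
      those of rank 0.\<close>
    obtain J where "J \<in> Mod_kb L KB"
      using M by blast
    with MS have "J \<in> S" "f J = 0"
      by (auto simp: f_def)
    then have "I \<in> minimals S (rank_rel S f) \<longleftrightarrow> I \<in> S \<and> f I = 0"
      by (auto simp: minimals_rank_rel)
    also have "\<dots> \<longleftrightarrow> I \<in> Mod_kb L KB"
      using MS by (auto simp: f_def)
    finally show ?thesis .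
  qed
  \<comment> \<open>The axiom relating different knowledge bases is met by assigning all of them the same order.\<close>
  then have "rational_order L KB (\<lambda>_. rank_rel S f)"
    by (simp add: rational_order_def Let_def preorder_on_rank_rel total_on_rank_rel
        minimals_rank_rel_nonempty flip: S_def)
  moreover have "N = minimals F (rank_rel S f)"
  proof -
    have "F \<subseteq> S"
      using F(1) by (simp add: S_def)
    have in_N: "f I = 1" if "I \<in> N" for I
      using that F(2) N(1) by (auto simp: f_def)
    have ge: "1 \<le> f I" if "I \<in> F" for I
      using that F(2) by (auto simp: f_def)
    \<comment> \<open>\<open>F\<close> avoids rank 0 and contains \<open>N\<close>, so its least
      rank is 1, attained exactly on \<open>N\<close>.\<close>
    obtain J where "J \<in> F" "f J = 1"
      using N in_N by blast
    then have "minimals F (rank_rel S f) = {I \<in> F. f I \<le> 1}"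
      using ge \<open>F \<subseteq> S\<close> by (auto simp: minimals_rank_rel intro: order.trans)
    also have "\<dots> = N"
      using N(1) F(2) by (auto simp: f_def split: if_splits)
    finally show ?thesis ..
  qed
  ultimately show ?thesis by blast
qed

text \<open>The two conjuncts are two readings of the hypothesis: for all rejected sentences, or for
  one fixed \<alpha>. In the second, \<open>Mod_kb L KB\<close> must be non-empty: otherwise the
  third axiom leaves \<open>S\<close> without minimal elements, while the revised models make
  \<open>S\<close> non-empty, against the fourth axiom.\<close>

theorem theorem11:
  fixes L :: "('f, 'p) lang"
    and KB :: "('f, 'p) kb"
    and rv :: "('f, 'p) kb \<Rightarrow> ('f, 'p) fm \<Rightarrow> ('f, 'p) kb"
  assumes "horn_kb L KB"
    and "revision_function L rv"
  shows
    "((\<forall>\<alpha> \<in> sentences L. rejected L KB \<alpha> \<longrightarrow>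
         Mod_kb L (rv KB \<alpha>) \<noteq> {} \<and>
         Mod_kb L (rv KB \<alpha>) \<subseteq> Mod_Disj L KB (min_explanations L KB \<alpha>))
      \<longrightarrow>
      (\<forall>\<alpha> \<in> sentences L. rejected L KB \<alpha> \<longrightarrow>
         (\<exists>leq. rational_order L KB leq \<and>
            Mod_kb L (rv KB \<alpha>) = minimals (Mod L KB ({\<alpha>} \<union> ic KB)) (leq KB))))
     \<and>
     (Mod_kb L KB \<noteq> {} \<longrightarrow>
      (\<forall>\<alpha> \<in> sentences L. rejected L KB \<alpha> \<longrightarrow>
         Mod_kb L (rv KB \<alpha>) \<noteq> {} \<and>
         Mod_kb L (rv KB \<alpha>) \<subseteq> Mod_Disj L KB (min_explanations L KB \<alpha>)
         \<longrightarrow>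
         (\<exists>leq. rational_order L KB leq \<and>
            Mod_kb L (rv KB \<alpha>) = minimals (Mod L KB ({\<alpha>} \<union> ic KB)) (leq KB))))"
proof -
  have order: "\<exists>leq. rational_order L KB leq \<and>
      Mod_kb L (rv KB \<alpha>) = minimals (Mod L KB ({\<alpha>} \<union> ic KB)) (leq KB)"
    if "Mod_kb L KB \<noteq> {}" "\<alpha> \<in> sentences L" "rejected L KB \<alpha>" "Mod_kb L (rv KB \<alpha>) \<noteq> {}"
      "Mod_kb L (rv KB \<alpha>) \<subseteq> Mod_Disj L KB (min_explanations L KB \<alpha>)" for \<alpha>
  proof (rule ex_rational_order)
    have eqs: "prog (rv KB \<alpha>) = prog KB" "abd (rv KB \<alpha>) = abd KB" "ic (rv KB \<alpha>) = ic KB"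
      using assms that(2) unfolding revision_function_def by blast+
    then have "Mod_kb L (rv KB \<alpha>) \<subseteq> Mod L KB (ic KB)"
      by (simp add: Mod_kb_def Mod_cong[OF eqs(1,2)] Mod_Un)
    then show "Mod_kb L (rv KB \<alpha>) \<subseteq> Mod L KB ({\<alpha>} \<union> ic KB)"
      using that(5) Mod_Disj_min_explanations unfolding Mod_Un by blast
    show "Mod L KB ({\<alpha>} \<union> ic KB) \<inter> Mod_kb L KB = {}"
      using that(3) unfolding rejected_iff[OF that(2)] Mod_Un by blast
    show "Mod L KB ({\<alpha>} \<union> ic KB) \<subseteq> Mod L KB (ic KB)"
      unfolding Mod_Un by blast
  qed (use that in blast)+
  \<comment> \<open>Here \<alpha> only supplies material for a contradictory sentence; a language
    without predicate symbols has no sentences.\<close>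
  moreover have "Mod_kb L KB \<noteq> {}"
    if all: "\<forall>\<alpha> \<in> sentences L. rejected L KB \<alpha> \<longrightarrow> Mod_kb L (rv KB \<alpha>) \<noteq> {} \<and>
        Mod_kb L (rv KB \<alpha>) \<subseteq> Mod_Disj L KB (min_explanations L KB \<alpha>)"
      and \<alpha>: "\<alpha> \<in> sentences L" for \<alpha>
  proof
    assume "Mod_kb L KB = {}"
    moreover have sent: "Conj \<alpha> (Neg \<alpha>) \<in> sentences L"
      using \<alpha> by (auto simp: sentences_def)
    ultimately have "rejected L KB (Conj \<alpha> (Neg \<alpha>))"
      by (simp add: rejected_iff)
    \<comment> \<open>The hypothesis, applied to the contradiction itself, would give it a
      model.\<close>
    with all sent have "Mod L KB {Conj \<alpha> (Neg \<alpha>)} \<noteq> {}"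
      using Mod_Disj_min_explanations[of L KB "Conj \<alpha> (Neg \<alpha>)"] by blast
    then show False by (simp add: Mod_def true_in_def)
  qed
  ultimately show ?thesis by blast
qed

end
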